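(* Let $G$ be a (finite, simple, nonempty) graph. (1) If $G$ is $k$-regular, then $Z(G)\geq k$. (2) If $G$ is bipartite and $k$-regular, then $Z(G)\geq 2(k-1)$.
   Context: Zero forcing: color the vertices of a set $B\subseteq V(G)$ black and the others white. A black vertex $v$ may force a white neighbor $w$ to become black if $w$ is the unique white neighbor of $v$. $B$ is a zero forcing set if repeated applications of this rule eventually make all vertices black. $Z(G)$ is the minimum size of a zero forcing set of $G$. *)

theory Defs
  imports "Graph_Theory.Digraph"
begin

text \<open>
  As in the library, a finite simple graph is a finite, loop-free, symmetric digraph without
  parallel arcs (locale \<^locale>\<open>graph\<close>); an undirected edge is a pair of opposite arcs, so
  the neighbours of \<open>v\<close> are the \<open>w\<close> with \<open>v \<rightarrow>\<^bsub>G\<^esub> w\<close>, and the degree of \<open>v\<close> is its out-degree.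
\<close>

definition regular_graph :: "nat \<Rightarrow> ('a, 'b) pre_digraph \<Rightarrow> bool" where
  "regular_graph k G \<longleftrightarrow> (\<forall>v \<in> verts G. out_degree G v = k)"

definition bipartite_graph :: "('a, 'b) pre_digraph \<Rightarrow> bool" where
  "bipartite_graph G \<longleftrightarrow>
     (\<exists>X Y. X \<union> Y = verts G \<and> X \<inter> Y = {} \<and>
        (\<forall>u v. u \<rightarrow>\<^bsub>G\<^esub> v \<longrightarrow> (u \<in> X \<and> v \<in> Y) \<or> (u \<in> Y \<and> v \<in> X)))"

text \<open>A single force \<open>v \<rightarrow> w\<close>; the set argument is the current set of black vertices.\<close>

inductive zf_step :: "('a, 'b) pre_digraph \<Rightarrow> 'a set \<Rightarrow> 'a set \<Rightarrow> bool"
  for G :: "('a, 'b) pre_digraph" where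
  force: "\<lbrakk>v \<in> B; w \<in> verts G - B; v \<rightarrow>\<^bsub>G\<^esub> w; \<forall>u \<in> verts G - B. v \<rightarrow>\<^bsub>G\<^esub> u \<longrightarrow> u = w\<rbrakk>
            \<Longrightarrow> zf_step G B (insert w B)"

definition zero_forcing_set :: "('a, 'b) pre_digraph \<Rightarrow> 'a set \<Rightarrow> bool" where
  "zero_forcing_set G B \<longleftrightarrow> B \<subseteq> verts G \<and> (zf_step G)\<^sup>*\<^sup>* B (verts G)"

definition zero_forcing_number :: "('a, 'b) pre_digraph \<Rightarrow> nat" where
  "zero_forcing_number G = (LEAST n. \<exists>B. zero_forcing_set G B \<and> card B = n)"

end

theory Submission
  imports Defs
begin

text \<open>
  Follow a forcing process up to the first force \<open>u \<rightarrow> w\<close> into a vertex set \<open>X\<close>. At that moment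
  all neighbours of \<open>u\<close> in \<open>X\<close> except \<open>w\<close> are black, and they were black from the start. With \<open>X\<close> the
  whole vertex set, \<open>u\<close> itself is a further initially black vertex, which gives \<open>k\<close> of them.
  With \<open>X\<close> one side of a bipartition, all \<open>k\<close> neighbours of \<open>u\<close> lie in \<open>X\<close>, so each of
  the two sides contains at least \<open>k - 1\<close> initially black vertices. A side that receives no force
  is black from the start and has at least \<open>k\<close> vertices.
\<close>

text \<open>Induction along the run: the trace on \<open>X\<close> either changed before the last
  step, or the last step is the first force into \<open>X\<close>. Only traces on \<open>X\<close>
  are compared, so \<open>B'\<close> may contain vertices outside \<open>X\<close> that turned black
  meanwhile.\<close>

lemma zf_first_force_into:
  assumes "(zf_step G)\<^sup>*\<^sup>* B C" and "C \<inter> X \<noteq> B \<inter> X"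
  obtains B' u w where "B' \<inter> X = B \<inter> X" "u \<in> B'" "w \<in> X - B'" "u \<rightarrow>\<^bsub>G\<^esub> w"
    "{v \<in> verts G. u \<rightarrow>\<^bsub>G\<^esub> v} \<subseteq> insert w B'"
  using assms
proof (induction arbitrary: thesis rule: rtranclp_induct)
  case base
  then show ?case by simp
next
  case (step C D)
  show ?case
  proof (cases "C \<inter> X = B \<inter> X")
    case False
    then show ?thesis using step.IH step.prems(1) by blast
  next
    case eq: True
    from step.hyps(2) show ?thesis
    proof cases
      case (force v w)
      \<comment> \<open>Here \<open>D = insert w C\<close>, so a forced vertex outside
        \<open>X\<close> would leave the trace unchanged.\<close>
      have "w \<in> X" using force(1) eq step.prems(2) by auto
      then show ?thesis using step.prems(1)[of C v w] force eq by blast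
    qed
  qed
qed

context graph
begin

lemma zero_forcing_number_attained:
  obtains B where "zero_forcing_set G B" and "card B = zero_forcing_number G"
proof -
  have "zero_forcing_set G (verts G)" by (simp add: zero_forcing_set_def)
  then have "\<exists>n B. zero_forcing_set G B \<and> card B = n" by blast
  then have "\<exists>B. zero_forcing_set G B \<and> card B = zero_forcing_number G"
    unfolding zero_forcing_number_def by (rule LeastI_ex)
  then show thesis using that by blast
qed

lemma neighbours_in_verts: "{w. v \<rightarrow>\<^bsub>G\<^esub> w} \<subseteq> verts G"
  by auto

text \<open>Without parallel arcs, \<open>head G\<close> is injective on the arcs leaving
  \<open>v\<close>.\<close>

lemma card_neighbours: "card {w. v \<rightarrow>\<^bsub>G\<^esub> w} = out_degree G v"
proof -
  have "inj_on (head G) (out_arcs G v)"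
    by (auto intro!: inj_onI no_multi_arcs simp: arc_to_ends_def)
  moreover have "head G ` out_arcs G v = {w. v \<rightarrow>\<^bsub>G\<^esub> w}"
    by (force simp: arcs_ends_def arc_to_ends_def)
  ultimately show ?thesis
    unfolding out_degree_def by (metis card_image)
qed

lemma card_zero_forcing_set_ge_degree:
  assumes "regular_graph k G" and "verts G \<noteq> {}" and zf: "zero_forcing_set G B"
  shows "k \<le> card B"
proof -
  have deg: "card {w. v \<rightarrow>\<^bsub>G\<^esub> w} = k" if "v \<in> verts G" for v
    using assms(1) that by (simp add: card_neighbours regular_graph_def)
  have B: "B \<subseteq> verts G" and steps: "(zf_step G)\<^sup>*\<^sup>* B (verts G)"
    using zf by (auto simp: zero_forcing_set_def)
  have fin: "finite B" using finite_subset[OF B] by simp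
  show ?thesis
  proof (cases "B = verts G")
    case True
    obtain v where "v \<in> verts G" using assms(2) by blast
    then show ?thesis using deg card_mono[OF fin] neighbours_in_verts True by metis
  next
    case False
    then have "verts G \<inter> verts G \<noteq> B \<inter> verts G" using B by auto
    with steps obtain B' u w where B': "B' \<inter> verts G = B \<inter> verts G"
      and u: "u \<in> B'" and w: "w \<in> verts G - B'" and uw: "u \<rightarrow>\<^bsub>G\<^esub> w"
      and nb: "{v \<in> verts G. u \<rightarrow>\<^bsub>G\<^esub> v} \<subseteq> insert w B'"
      by (rule zf_first_force_into)
    have uV: "u \<in> verts G" using uw by auto
    have uB: "u \<in> B" using u uV B' by blast
    \<comment> \<open>There are no loops, so \<open>u\<close> is not its own neighbour and can be
      removed; \<open>w\<close> takes its place in the count.\<close>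
    have "{v. u \<rightarrow>\<^bsub>G\<^esub> v} \<subseteq> insert w (B - {u})"
      using nb B' neighbours_in_verts[of u] adj_not_same by blast
    then have "k \<le> card (insert w (B - {u}))"
      using card_mono[of "insert w (B - {u})"] fin deg[OF uV] by fastforce
    also have "\<dots> \<le> Suc (card (B - {u}))" by (rule card_insert_le_m1) auto
    also have "\<dots> = card B" using fin uB by (rule card_Suc_Diff1)
    finally show ?thesis .
  qed
qed

text \<open>The assumption \<open>nb_X\<close> describes a side of a bipartition without mentioning
  the other one, so the lemma applies to both. The arc from \<open>y\<close> to \<open>x\<close>
  supplies a neighbourhood inside \<open>X\<close> when no force enters \<open>X\<close>.\<close>

lemma card_zero_forcing_set_Int_ge:
  assumes "regular_graph k G" and zf: "zero_forcing_set G B"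
    and nb_X: "\<And>u v w. \<lbrakk>u \<rightarrow>\<^bsub>G\<^esub> v; v \<in> X; u \<rightarrow>\<^bsub>G\<^esub> w\<rbrakk> \<Longrightarrow> w \<in> X"
    and yx: "y \<rightarrow>\<^bsub>G\<^esub> x" "x \<in> X"
  shows "k \<le> Suc (card (B \<inter> X))"
proof -
  have deg: "card {w. v \<rightarrow>\<^bsub>G\<^esub> w} = k" if "v \<in> verts G" for v
    using assms(1) that by (simp add: card_neighbours regular_graph_def)
  have B: "B \<subseteq> verts G" and steps: "(zf_step G)\<^sup>*\<^sup>* B (verts G)"
    using zf by (auto simp: zero_forcing_set_def)
  have fin: "finite (B \<inter> X)" using finite_subset[OF B] by simp
  have "\<exists>u v w. u \<rightarrow>\<^bsub>G\<^esub> v \<and> {v. u \<rightarrow>\<^bsub>G\<^esub> v} \<subseteq> insert w (B \<inter> X)"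
  proof (cases "verts G \<inter> X = B \<inter> X")
    case True
    have "{v. y \<rightarrow>\<^bsub>G\<^esub> v} \<subseteq> verts G \<inter> X"
      using nb_X yx neighbours_in_verts by blast
    \<comment> \<open>Any \<open>w\<close> will do: the neighbourhood of \<open>y\<close> already
      lies in \<open>B \<inter> X\<close>.\<close>
    then show ?thesis using True yx by blast
  next
    case False
    with steps obtain B' u w where "B' \<inter> X = B \<inter> X" "w \<in> X - B'" "u \<rightarrow>\<^bsub>G\<^esub> w"
      "{v \<in> verts G. u \<rightarrow>\<^bsub>G\<^esub> v} \<subseteq> insert w B'"
      by (rule zf_first_force_into)
    moreover from this have "{v. u \<rightarrow>\<^bsub>G\<^esub> v} \<subseteq> verts G \<inter> X"
      using nb_X neighbours_in_verts by blast
    ultimately show ?thesis by blast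
  qed
  then obtain u v w where uv: "u \<rightarrow>\<^bsub>G\<^esub> v" and sub: "{v. u \<rightarrow>\<^bsub>G\<^esub> v} \<subseteq> insert w (B \<inter> X)"
    by blast
  have "k = card {v. u \<rightarrow>\<^bsub>G\<^esub> v}" using deg uv by auto
  also have "\<dots> \<le> card (insert w (B \<inter> X))" using fin sub by (intro card_mono) auto
  also have "\<dots> \<le> Suc (card (B \<inter> X))" by (rule card_insert_le_m1) auto
  finally show ?thesis .
qed

text \<open>The bounds for the two sides add up because the sides are disjoint. The additive form
  avoids truncated subtraction on \<open>nat\<close>.\<close>

lemma card_zero_forcing_set_bipartite_ge:
  assumes "bipartite_graph G" and reg: "regular_graph k G"
    and "verts G \<noteq> {}" and zf: "zero_forcing_set G B"
  shows "2 * k \<le> card B + 2"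
proof (cases "k = 0")
  case False
  obtain X Y where XY: "X \<inter> Y = {}"
    and bip: "\<And>u v. u \<rightarrow>\<^bsub>G\<^esub> v \<Longrightarrow> (u \<in> X \<and> v \<in> Y) \<or> (u \<in> Y \<and> v \<in> X)"
    using assms(1) unfolding bipartite_graph_def by blast
  obtain v where "v \<in> verts G" using assms(3) by blast
  then have "card {w. v \<rightarrow>\<^bsub>G\<^esub> w} \<noteq> 0"
    using reg False by (simp add: card_neighbours regular_graph_def)
  then obtain w where "v \<rightarrow>\<^bsub>G\<^esub> w" by (metis card.empty empty_Collect_eq)
  \<comment> \<open>Whichever side \<open>v\<close> is on, symmetry gives both arcs of the edge: one
    enters \<open>X\<close>, the other \<open>Y\<close>.\<close>
  then obtain x y where xy: "x \<rightarrow>\<^bsub>G\<^esub> y" "y \<rightarrow>\<^bsub>G\<^esub> x" "x \<in> X" "y \<in> Y"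
    using bip[of v w] arcs_ends_symmetric[OF sym_arcs, of v w] by blast
  have "k \<le> Suc (card (B \<inter> X))"
    by (rule card_zero_forcing_set_Int_ge[OF reg zf _ xy(2,3)]) (use bip XY in blast)
  moreover have "k \<le> Suc (card (B \<inter> Y))"
    by (rule card_zero_forcing_set_Int_ge[OF reg zf _ xy(1,4)]) (use bip XY in blast)
  moreover have "card (B \<inter> X) + card (B \<inter> Y) \<le> card B"
  proof -
    have "finite B" using zf finite_subset[of B "verts G"] by (simp add: zero_forcing_set_def)
    then have "card (B \<inter> X) + card (B \<inter> Y) = card (B \<inter> X \<union> B \<inter> Y)"
      using XY by (intro card_Un_disjoint[symmetric]) auto
    also have "\<dots> \<le> card B" using \<open>finite B\<close> by (intro card_mono) auto
    finally show ?thesis .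
  qed
  ultimately show ?thesis by linarith
qed simp

end

theorem lemma3p3:
  fixes G :: "('a, 'b) pre_digraph" and k :: nat
  assumes "graph G" and "verts G \<noteq> {}"
  shows "(regular_graph k G \<longrightarrow> zero_forcing_number G \<ge> k) \<and>
         (bipartite_graph G \<and> regular_graph k G \<longrightarrow>
            int (zero_forcing_number G) \<ge> 2 * (int k - 1))"
proof -
  interpret graph G by fact
  obtain B where B: "zero_forcing_set G B" "card B = zero_forcing_number G"
    by (rule zero_forcing_number_attained)
  have "k \<le> zero_forcing_number G" if "regular_graph k G"
    using card_zero_forcing_set_ge_degree[OF that assms(2) B(1)] B(2) by simp
  moreover have "2 * k \<le> zero_forcing_number G + 2"
    if "bipartite_graph G" "regular_graph k G"
    using card_zero_forcing_set_bipartite_ge[OF that assms(2) B(1)] B(2) by simp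
  ultimately show ?thesis by force
qed

end
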